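(* Let $N=(P,T,\mathrm{Pre},\mathrm{Post},m_0)$ be a marked Petri net and let $t\in T$ be a redundant transition of $N$. Let $N'=(P,T\setminus\{t\},\mathrm{Pre}|_{T\setminus\{t\}},\mathrm{Post}|_{T\setminus\{t\}},m_0)$ be the net obtained from $N$ by removing $t$. Then $\mathcal{R}(N)=\mathcal{R}(N')$.
   Context: A marked Petri net is a tuple $N=(P,T,\mathrm{Pre},\mathrm{Post},m_0)$ with $P,T$ disjoint finite sets (places and transitions), $\mathrm{Pre},\mathrm{Post}:T\to(P\to\mathbb{N})$, and initial marking $m_0:P\to\mathbb{N}$. A marking is a map $m:P\to\mathbb{N}$; comparisons and arithmetic on such maps are pointwise. A transition $t$ is enabled at $m$ if $m\ge \mathrm{Pre}(t)$, and then firing it yields $m'=m-\mathrm{Pre}(t)+\mathrm{Post}(t)$, written $m\xrightarrow{t}m'$. A firing sequence is a sequence $t_1,\dots,t_n$ of transitions such that there are markings $m_1,\dots,m_{n+1}$ with $m_i\xrightarrow{t_i}m_{i+1}$ for all $i$. The reachability set $\mathcal{R}(N)$ is the set of markings reachable from $m_0$ by finitely many firings. The displacement of a sequence $\sigma=t_1\cdots t_n$ is $\Delta(\sigma)=\sum_{i=1}^n(\mathrm{Post}(t_i)-\mathrm{Pre}(t_i)):P\to\mathbb{Z}$, and its hurdle $H(\sigma)$ is the pointwise smallest marking from which $\sigma$ is firable. A transition $t\in T$ is redundant if there is a firing sequence $\sigma$ over $T\setminus\{t\}$ such that $\Delta(t)=\Delta(\sigma)$ and $H(t)\ge H(\sigma)$.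 *)

theory Defs
  imports Main "HOL-Library.FuncSet"
begin

text \<open>
  Places and transitions are drawn from a common type, so that their disjointness is a
  condition. Maps with domain \<open>P\<close> or \<open>T\<close> are extensional functions (\<open>undefined\<close> outside their
  domain); hence equality and the library order \<open>\<le>\<close> on these functions are
  exactly pointwise equality and order on the domain.
\<close>

record 'a net =
  places :: "'a set"
  transitions :: "'a set"
  pre :: "'a \<Rightarrow> 'a \<Rightarrow> nat"
  post :: "'a \<Rightarrow> 'a \<Rightarrow> nat"
  initial :: "'a \<Rightarrow> nat"

definition markings :: "'a net \<Rightarrow> ('a \<Rightarrow> nat) set" where
  "markings N = (places N \<rightarrow>\<^sub>E UNIV)"

definition petri_net :: "'a net \<Rightarrow> bool" where
  "petri_net N \<longleftrightarrow>
     finite (places N) \<and> finite (transitions N) \<and> places N \<inter> transitions N = {} \<and>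
     pre N \<in> (transitions N \<rightarrow>\<^sub>E markings N) \<and>
     post N \<in> (transitions N \<rightarrow>\<^sub>E markings N) \<and>
     initial N \<in> markings N"

definition enabled :: "'a net \<Rightarrow> ('a \<Rightarrow> nat) \<Rightarrow> 'a \<Rightarrow> bool" where
  "enabled N m t \<longleftrightarrow> m \<in> markings N \<and> t \<in> transitions N \<and> pre N t \<le> m"

definition fire :: "'a net \<Rightarrow> ('a \<Rightarrow> nat) \<Rightarrow> 'a \<Rightarrow> ('a \<Rightarrow> nat) \<Rightarrow> bool" where
  "fire N m t m' \<longleftrightarrow>
     enabled N m t \<and> m' = (\<lambda>p\<in>places N. m p - pre N t p + post N t p)"

inductive fires :: "'a net \<Rightarrow> ('a \<Rightarrow> nat) \<Rightarrow> 'a list \<Rightarrow> ('a \<Rightarrow> nat) \<Rightarrow> bool" for N where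
  Nil: "m \<in> markings N \<Longrightarrow> fires N m [] m"
| Cons: "fire N m t m' \<Longrightarrow> fires N m' \<sigma> m'' \<Longrightarrow> fires N m (t # \<sigma>) m''"

inductive_cases fires_ConsE: "fires N m (t # \<sigma>) m''"

definition firable :: "'a net \<Rightarrow> ('a \<Rightarrow> nat) \<Rightarrow> 'a list \<Rightarrow> bool" where
  "firable N m \<sigma> \<longleftrightarrow> (\<exists>m'. fires N m \<sigma> m')"

text \<open>A firing sequence may start at any marking, not only at the initial one.\<close>

definition firing_sequence :: "'a net \<Rightarrow> 'a list \<Rightarrow> bool" where
  "firing_sequence N \<sigma> \<longleftrightarrow> (\<exists>m. firable N m \<sigma>)"

definition reachability_set :: "'a net \<Rightarrow> ('a \<Rightarrow> nat) set" where
  "reachability_set N = {m. \<exists>\<sigma>. fires N (initial N) \<sigma> m}"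

definition displacement :: "'a net \<Rightarrow> 'a list \<Rightarrow> 'a \<Rightarrow> int" where
  "displacement N \<sigma> = (\<lambda>p\<in>places N. \<Sum>t\<leftarrow>\<sigma>. int (post N t p) - int (pre N t p))"

text \<open>
  The order on functions is partial; a least element exists by \<open>hurdle_exists\<close> below.
\<close>

definition hurdle :: "'a net \<Rightarrow> 'a list \<Rightarrow> 'a \<Rightarrow> nat" where
  "hurdle N \<sigma> = (LEAST m. firable N m \<sigma>)"

definition redundant :: "'a net \<Rightarrow> 'a \<Rightarrow> bool" where
  "redundant N t \<longleftrightarrow> t \<in> transitions N \<and>
     (\<exists>\<sigma>. firing_sequence N \<sigma> \<and> set \<sigma> \<subseteq> transitions N - {t} \<and>
          displacement N [t] = displacement N \<sigma> \<and> hurdle N [t] \<ge> hurdle N \<sigma>)"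

definition remove_transition :: "'a net \<Rightarrow> 'a \<Rightarrow> 'a net" where
  "remove_transition N t =
     N\<lparr>transitions := transitions N - {t},
       pre := restrict (pre N) (transitions N - {t}),
       post := restrict (post N) (transitions N - {t})\<rparr>"

lemma petri_net_remove_transition:
  assumes "petri_net N"
  shows "petri_net (remove_transition N t)"
  using assms unfolding petri_net_def remove_transition_def markings_def
  by (auto simp: PiE_iff)

lemma firable_Nil: "firable N m [] \<longleftrightarrow> m \<in> markings N"
  unfolding firable_def by (auto intro: fires.Nil elim: fires.cases)

lemma firable_Cons:
  "firable N m (t # \<sigma>) \<longleftrightarrow> (\<exists>m'. fire N m t m' \<and> firable N m' \<sigma>)"
  unfolding firable_def by (blast intro: fires.Cons elim: fires_ConsE)

lemma hurdle_exists:
  assumes N: "petri_net N" and "set \<sigma> \<subseteq> transitions N"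
  shows "\<exists>h\<in>markings N. \<forall>m. firable N m \<sigma> \<longleftrightarrow> m \<in> markings N \<and> h \<le> m"
  using assms(2)
proof (induction \<sigma>)
  case Nil
  have "(\<lambda>p\<in>places N. 0) \<le> m" if "m \<in> markings N" for m
    using that by (auto simp: le_fun_def markings_def restrict_def PiE_iff extensional_def)
  moreover have "(\<lambda>p\<in>places N. 0) \<in> markings N" by (auto simp: markings_def)
  ultimately show ?case unfolding firable_Nil by blast
next
  case (Cons t \<sigma>)
  then obtain h where h: "h \<in> markings N"
    "\<And>m. firable N m \<sigma> \<longleftrightarrow> m \<in> markings N \<and> h \<le> m" by auto
  have t: "t \<in> transitions N" "pre N t \<in> markings N"
    using Cons.prems N by (auto simp: petri_net_def PiE_iff)
  let ?g = "\<lambda>p\<in>places N. max (pre N t p) (h p + pre N t p - post N t p)"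
  have "firable N m (t # \<sigma>) \<longleftrightarrow> m \<in> markings N \<and> ?g \<le> m" for m
  proof (cases "m \<in> markings N")
    case True
    have out: "m p = undefined" "h p = undefined" "pre N t p = undefined" if "p \<notin> places N" for p
      using that True h(1) t(2) by (auto simp: markings_def PiE_iff extensional_def)
    let ?m = "\<lambda>p\<in>places N. m p - pre N t p + post N t p"
    have "?m \<in> markings N" by (auto simp: markings_def)
    then have "firable N m (t # \<sigma>) \<longleftrightarrow> pre N t \<le> m \<and> h \<le> ?m"
      using True t by (auto simp: firable_Cons fire_def enabled_def h(2))
    also have "\<dots> \<longleftrightarrow> (\<forall>p. pre N t p \<le> m p \<and> h p \<le> ?m p)"
      by (auto simp: le_fun_def)
    also have "\<dots> \<longleftrightarrow> (\<forall>p. ?g p \<le> m p)"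
    proof (rule arg_cong[where f = All], rule ext)
      fix p
      show "(pre N t p \<le> m p \<and> h p \<le> ?m p) = (?g p \<le> m p)"
        by (cases "p \<in> places N") (auto simp: out)
    qed
    finally show ?thesis using True by (simp add: le_fun_def)
  qed (auto simp: firable_Cons fire_def enabled_def)
  moreover have "?g \<in> markings N" by (auto simp: markings_def)
  ultimately show ?case by blast
qed

lemma firable_iff_hurdle_le:
  assumes "petri_net N" and "set \<sigma> \<subseteq> transitions N"
  shows "hurdle N \<sigma> \<in> markings N"
    and "firable N m \<sigma> \<longleftrightarrow> m \<in> markings N \<and> hurdle N \<sigma> \<le> m"
proof -
  obtain h where h: "h \<in> markings N"
    "\<And>m. firable N m \<sigma> \<longleftrightarrow> m \<in> markings N \<and> h \<le> m"
    using hurdle_exists[OF assms] by blast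
  then have "hurdle N \<sigma> = h"
    unfolding hurdle_def by (intro Least_equality) auto
  with h show "hurdle N \<sigma> \<in> markings N"
    and "firable N m \<sigma> \<longleftrightarrow> m \<in> markings N \<and> hurdle N \<sigma> \<le> m" by auto
qed

end

theory Submission
  imports Defs
begin

text \<open>
  A replacement sequence for \<open>t\<close> is firable wherever \<open>t\<close> is enabled, because its hurdle
  is no larger, and it leads to the same marking, because the marking reached depends only on the
  starting marking and the displacement. So each firing of \<open>t\<close> can be spliced out of a run.
\<close>

lemma fires_append:
  assumes "fires N m \<sigma> m'" and "fires N m' \<tau> m''"
  shows "fires N m (\<sigma> @ \<tau>) m''"
  using assms by induction (auto intro: fires.Cons)

lemma fires_start_in_markings: "fires N m \<sigma> m' \<Longrightarrow> m \<in> markings N"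
  by (erule fires.cases) (auto simp: fire_def enabled_def)

lemma fires_end_in_markings: "fires N m \<sigma> m' \<Longrightarrow> m' \<in> markings N"
  by (induction rule: fires.induct)

text \<open>Enabledness gives \<open>pre N t p \<le> m p\<close> at each firing, so the truncated
  subtraction on naturals agrees with integer subtraction and the changes add up.\<close>

lemma fires_displacement:
  assumes "fires N m \<sigma> m'" and "p \<in> places N"
  shows "int (m' p) = int (m p) + displacement N \<sigma> p"
  using assms
proof induction
  case (Cons m t m' \<sigma> m'')
  then have "pre N t p \<le> m p" "m' p = m p - pre N t p + post N t p"
    by (auto simp: fire_def enabled_def le_fun_def)
  with Cons show ?case by (simp add: displacement_def of_nat_diff)
qed (simp add: displacement_def)

lemma fires_same_displacement:
  assumes "fires N m \<sigma> m1" and "fires N m \<tau> m2" and "displacement N \<sigma> = displacement N \<tau>"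
  shows "m1 = m2"
proof (rule PiE_ext)
  \<comment> \<open>Markings are extensional, so agreement on \<open>places N\<close>
    suffices.\<close>
  show "m1 \<in> places N \<rightarrow>\<^sub>E UNIV" "m2 \<in> places N \<rightarrow>\<^sub>E UNIV"
    using assms(1,2)[THEN fires_end_in_markings] by (simp_all add: markings_def)
  show "m1 p = m2 p" if "p \<in> places N" for p
    using assms(1,2)[THEN fires_displacement[OF _ that]] assms(3) by simp
qed

text \<open>Removal keeps the places, hence the markings, and leaves \<open>pre\<close> and
  \<open>post\<close> unchanged on the remaining transitions.\<close>

lemma fire_remove_transition:
  "fire (remove_transition N t) m u m' \<longleftrightarrow> fire N m u m' \<and> u \<noteq> t"
  by (auto simp: fire_def enabled_def remove_transition_def markings_def)

text \<open>Turns the comparison of two nets into a question about runs of \<open>N\<close> alone: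
  can they avoid \<open>t\<close>?\<close>

lemma fires_remove_transition:
  "fires (remove_transition N t) m \<sigma> m' \<longleftrightarrow> fires N m \<sigma> m' \<and> t \<notin> set \<sigma>"
proof (induction \<sigma> arbitrary: m)
  case Nil
  have "markings (remove_transition N t) = markings N"
    by (simp add: markings_def remove_transition_def)
  then show ?case by (auto intro: fires.Nil elim: fires.cases)
next
  case (Cons u \<sigma>)
  then show ?case
    by (auto simp: fire_remove_transition elim!: fires_ConsE intro: fires.Cons)
qed

lemma redundant_fire_replaced:
  assumes N: "petri_net N" and "redundant N t" and "fire N m t m'"
  obtains \<sigma> where "fires N m \<sigma> m'" and "t \<notin> set \<sigma>"
proof -
  obtain \<sigma> where \<sigma>: "set \<sigma> \<subseteq> transitions N - {t}"
    "displacement N [t] = displacement N \<sigma>" "hurdle N \<sigma> \<le> hurdle N [t]"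
    and t: "t \<in> transitions N"
    using assms(2) by (auto simp: redundant_def)
  have m': "m' \<in> markings N"
    using assms(3) by (auto simp: fire_def markings_def)
  have single: "fires N m [t] m'"
    by (rule fires.Cons[OF assms(3) fires.Nil[OF m']])
  \<comment> \<open>Since \<open>[t]\<close> is firable at \<open>m\<close>, its hurdle lies below
    \<open>m\<close>; by transitivity so does \<open>hurdle N \<sigma>\<close>.\<close>
  then have "m \<in> markings N \<and> hurdle N [t] \<le> m"
    using firable_iff_hurdle_le(2)[OF N, of "[t]" m] t by (auto simp: firable_def)
  then have "firable N m \<sigma>"
    using firable_iff_hurdle_le(2)[OF N, of \<sigma> m] \<sigma>(1,3) by (auto intro: order_trans)
  then obtain m'' where m'': "fires N m \<sigma> m''" by (auto simp: firable_def)
  then have "m'' = m'"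
    using fires_same_displacement[OF single m'' \<sigma>(2)] by simp
  with m'' \<sigma>(1) show thesis by (auto intro: that)
qed

text \<open>Induction along the run: the first firing becomes a run \<open>\<rho>\<close> avoiding
  \<open>t\<close>, prepended to the run \<open>\<sigma>\<close> from the induction
  hypothesis.\<close>

lemma redundant_fires_replaced:
  assumes N: "petri_net N" and t: "redundant N t" and "fires N m \<tau> m'"
  shows "\<exists>\<sigma>. fires N m \<sigma> m' \<and> t \<notin> set \<sigma>"
  using assms(3)
proof induction
  case (Nil m)
  then have "fires N m [] m" by (rule fires.Nil)
  then show ?case by force
next
  case (Cons m u m' \<tau> m'')
  from Cons.IH obtain \<sigma> where \<sigma>: "fires N m' \<sigma> m''" "t \<notin> set \<sigma>" by blast
  obtain \<rho> where "fires N m \<rho> m'" "t \<notin> set \<rho>"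
  proof (cases "u = t")
    case True
    with redundant_fire_replaced[OF N t] Cons.hyps(1) that show ?thesis by blast
  next
    case False
    \<comment> \<open>The empty run after \<open>u\<close> needs \<open>m'\<close> to be a marking;
      it is one because \<open>\<sigma>\<close> starts there.\<close>
    have "fires N m [u] m'"
      using Cons.hyps(1) fires.Nil[OF fires_start_in_markings[OF \<sigma>(1)]] by (rule fires.Cons)
    with False that show ?thesis by force
  qed
  with \<sigma> have "fires N m (\<rho> @ \<sigma>) m''" "t \<notin> set (\<rho> @ \<sigma>)"
    by (auto intro: fires_append)
  then show ?case by blast
qed

theorem theorem1:
  fixes N :: "'a net" and t :: 'a
  assumes "petri_net N"
    and "t \<in> transitions N"
    and "redundant N t"
  shows "reachability_set N = reachability_set (remove_transition N t)"
proof -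
  have "initial (remove_transition N t) = initial N"
    by (simp add: remove_transition_def)
  \<comment> \<open>A run of the reduced net is already a run of \<open>N\<close>; replacement gives
    the other inclusion.\<close>
  then show ?thesis
    using redundant_fires_replaced[OF assms(1,3)]
    by (auto simp: reachability_set_def fires_remove_transition)
qed

end
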